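(* Let $f:\mathbb{R}^n\to\mathbb{R}$ be continuously differentiable with gradient Lipschitz continuous on the unit simplex $\Delta$ with constant $L>0$. Let $C>0$ and let $\epsilon$ satisfy $0<\epsilon\le\frac{2}{nL(2C+1)}$. Let $x\in\Delta$ be a non-stationary point of $\min_{x\in\Delta}f(x)$, let $j\in J(x)$, $I=\{1,\dots,n\}\setminus\{j\}$, and let $\hat A(x)\subseteq A(x)$ be any set of indices. Let $\tilde x$ be the feasible point defined by $$\tilde x_{\hat A(x)}=0,\qquad \tilde x_{I\setminus\hat A(x)}=x_{I\setminus\hat A(x)},\qquad \tilde x_j=x_j+\sum_{i\in\hat A(x)}x_i.$$ Then $$f(\tilde x)-f(x)\le -CL\|\tilde x-x\|^2.$$
   Context: $\Delta=\{x\in\mathbb{R}^n: e^Tx=1,\ x\ge 0\}$, where $e$ is the all-ones vector; $e_i$ is the $i$th unit vector; $\|\cdot\|$ is the Euclidean norm; $v_I$ is the subvector of $v$ with components indexed by $I$. A point $x^*\in\Delta$ is stationary for $\min_\Delta f$ if there are $\lambda^*\in\mathbb{R}$, $\mu^*\in\mathbb{R}^n$ with $\nabla f(x^* )-\lambda^*e-\mu^*=0$, $(\mu^* )^Tx^*=0$, $\mu^*\ge0$; equivalently $\nabla f(x^* )^T(e_i-x^* )\ge 0$ for all $i$. For $x\in\Delta$ and the parameter $\epsilon>0$: $A(x)=\{i: x_i\le\epsilon\nabla f(x)^T(e_i-x)\}$ is the active-set estimate, and $J(x)=\operatorname{Argmin}_{i=1,\dots,n}\nabla_i f(x)$. (For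 non-stationary $x$ one has $J(x)\cap A(x)=\emptyset$.) *)

theory Defs
  imports "HOL-Analysis.Analysis"
begin

definition std_simplex :: "(real ^ 'n) set"
  where "std_simplex = {x. vec 1 \<bullet> x = 1 \<and> (\<forall>i. 0 \<le> x $ i)}"

definition gradient :: "('a::real_inner \<Rightarrow> real) \<Rightarrow> 'a \<Rightarrow> 'a"
  where "gradient f x = (THE D. GDERIV f x :> D)"

lemma gradient_eqI:
  assumes "GDERIV f x :> D"
  shows "gradient f x = D"
  unfolding gradient_def
proof (rule the_equality)
  show "GDERIV f x :> D" by fact
next
  fix D' assume "GDERIV f x :> D'"
  with assms have "(\<lambda>h. h \<bullet> D') = (\<lambda>h. h \<bullet> D)"
    unfolding gderiv_def by (rule has_derivative_unique[rotated])
  then show "D' = D"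
    by (metis vector_eq_ldot)
qed

lemma GDERIV_gradient:
  fixes f :: "'a::euclidean_space \<Rightarrow> real"
  assumes "f differentiable at x"
  shows "GDERIV f x :> gradient f x"
proof -
  obtain f' where f': "(f has_derivative f') (at x)"
    using assms by (auto simp: differentiable_def)
  then have "linear f'"
    by (rule has_derivative_linear)
  then have "f' h = h \<bullet> adjoint f' 1" for h
    using adjoint_works[of f' h 1] by simp
  then have "f' = (\<lambda>h. h \<bullet> adjoint f' 1)" by blast
  with f' have "GDERIV f x :> adjoint f' 1"
    by (simp add: gderiv_def)
  then show ?thesis
    using gradient_eqI by metis
qed

definition stationary_point :: "(real ^ 'n \<Rightarrow> real) \<Rightarrow> real ^ 'n \<Rightarrow> bool"
  where "stationary_point f x \<longleftrightarrow>
    x \<in> std_simplex \<and>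
    (\<exists>l \<mu>. gradient f x - l *\<^sub>R vec 1 - \<mu> = 0 \<and> \<mu> \<bullet> x = 0 \<and> (\<forall>i. 0 \<le> \<mu> $ i))"

definition active_set_estimate :: "(real ^ 'n \<Rightarrow> real) \<Rightarrow> real \<Rightarrow> real ^ 'n \<Rightarrow> 'n set"
  where "active_set_estimate f \<epsilon> x =
    {i. x $ i \<le> \<epsilon> * (gradient f x \<bullet> (axis i 1 - x))}"

definition min_gradient_indices :: "(real ^ 'n \<Rightarrow> real) \<Rightarrow> real ^ 'n \<Rightarrow> 'n set"
  where "min_gradient_indices f x =
    {j. is_arg_min (\<lambda>i. gradient f x $ i) (\<lambda>i. True) j}"

end

theory Submission
  imports Defs
begin

text \<open>
  Since \<open>x\<close> is not stationary, \<open>j \<notin> A'\<close>, and the step \<open>d = x' - x\<close> only moves the mass of the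
  coordinates in \<open>A'\<close> to coordinate \<open>j\<close>. Writing \<open>g\<close> for the gradient at \<open>x\<close>, minimality of \<open>g\<^sub>j\<close>
  gives \<open>g\<^sub>j \<le> g \<bullet> x\<close>, so every \<open>i \<in> A'\<close> satisfies \<open>x\<^sub>i \<le> \<epsilon> (g\<^sub>i - g\<^sub>j)\<close> and hence
  \<open>\<epsilon> (g \<bullet> d) \<le> - s\<close> with \<open>s = (\<Sum>i\<in>A'. x\<^sub>i\<^sup>2)\<close>, while Cauchy--Schwarz gives \<open>\<parallel>d\<parallel>\<^sup>2 \<le> n s\<close>.
  The descent lemma \<open>f x' - f x \<le> g \<bullet> d + L / 2 \<cdot> \<parallel>d\<parallel>\<^sup>2\<close> and the bound on \<open>\<epsilon>\<close> then conclude.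
\<close>

text \<open>Along the segment from \<open>x\<close> to \<open>y\<close>, \<open>f\<close> minus its
  quadratic upper model, up to a constant, is nonincreasing: the derivative is nonpositive by
  Cauchy-Schwarz and the Lipschitz bound. Convexity keeps the segment inside \<open>S\<close>, where
  that bound holds.\<close>

lemma descent_lemma:
  fixes f :: "'a::euclidean_space \<Rightarrow> real"
  assumes S: "convex S" "x \<in> S" "y \<in> S"
    and diff: "\<And>z. z \<in> S \<Longrightarrow> f differentiable at z"
    and lip: "L-lipschitz_on S (gradient f)"
  shows "f y - f x \<le> gradient f x \<bullet> (y - x) + L / 2 * (norm (y - x))\<^sup>2"
proof -
  define d where "d = y - x"
  define h where
    "h t = f (x + t *\<^sub>R d) - t * (gradient f x \<bullet> d) - L / 2 * t\<^sup>2 * (norm d)\<^sup>2" for t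
  have "h 1 \<le> h 0"
  proof (rule DERIV_nonpos_imp_nonincreasing[where f = h])
    fix t :: real
    assume t: "0 \<le> t" "t \<le> 1"
    define z where "z = x + t *\<^sub>R d"
    define D where "D = gradient f z \<bullet> d - gradient f x \<bullet> d - L * t * (norm d)\<^sup>2"
    have "z = (1 - t) *\<^sub>R x + t *\<^sub>R y"
      by (simp add: z_def d_def algebra_simps)
    then have z: "z \<in> S"
      using S t by (simp add: convexD)
    have fz: "(f has_derivative (\<lambda>v. v \<bullet> gradient f z)) (at (x + t *\<^sub>R d))"
      using GDERIV_gradient[OF diff[OF z]] by (simp add: gderiv_def z_def)
    have "((\<lambda>t. x + t *\<^sub>R d) has_derivative (\<lambda>s. s *\<^sub>R d)) (at t)"
      by (auto intro!: derivative_eq_intros)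
    from diff_chain_at[OF this fz]
    have "((\<lambda>t. f (x + t *\<^sub>R d)) has_real_derivative (gradient f z \<bullet> d)) (at t)"
      by (simp add: has_field_derivative_def o_def inner_commute mult_commute_abs)
    then have "DERIV h t :> D"
      unfolding h_def D_def by (auto intro!: derivative_eq_intros)
    moreover have "D \<le> 0"
    proof -
      have "(gradient f z - gradient f x) \<bullet> d \<le> norm (gradient f z - gradient f x) * norm d"
        by (rule norm_cauchy_schwarz)
      also have "\<dots> \<le> L * norm (z - x) * norm d"
        using lipschitz_onD[OF lip z S(2)] by (simp add: dist_norm mult_right_mono)
      also have "norm (z - x) = t * norm d"
        using t by (simp add: z_def)
      finally show ?thesis
        by (simp add: D_def power2_eq_square inner_diff_left algebra_simps)
    qed
    ultimately show "\<exists>D. DERIV h t :> D \<and> D \<le> 0" by blast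
  qed simp
  then show ?thesis
    by (simp add: h_def d_def)
qed

lemma vec_one_inner: "vec 1 \<bullet> (v :: real ^ 'n) = (\<Sum>i\<in>UNIV. v $ i)"
  by (simp add: inner_vec_def)

lemma convex_std_simplex: "convex (std_simplex :: (real ^ 'n) set)"
  unfolding convex_def std_simplex_def
  by (auto simp: inner_add_right)

text \<open>On the simplex the inner product is a convex combination of the gradient components,
  hence at least the smallest of them.\<close>

lemma min_gradient_le:
  assumes "x \<in> std_simplex" "j \<in> min_gradient_indices f x"
  shows "gradient f x $ j \<le> gradient f x \<bullet> x"
proof -
  have "gradient f x $ j = (\<Sum>i\<in>UNIV. gradient f x $ j * x $ i)"
    using assms(1) unfolding std_simplex_def vec_one_inner
    by (simp flip: sum_distrib_left)
  also have "\<dots> \<le> (\<Sum>i\<in>UNIV. gradient f x $ i * x $ i)"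
    using assms by (intro sum_mono mult_right_mono)
      (auto simp: std_simplex_def min_gradient_indices_def is_arg_min_linorder)
  finally show ?thesis
    by (simp add: inner_vec_def)
qed

text \<open>Membership would force equality in \<open>min_gradient_le\<close>. Then the multipliers
  \<open>l = ?g $ j\<close> and \<open>\<mu> = ?g - ?g $ j *\<^sub>R vec 1\<close> certify
  stationarity.\<close>

lemma min_gradient_not_active:
  assumes x: "x \<in> std_simplex" and ns: "\<not> stationary_point f x"
    and j: "j \<in> min_gradient_indices f x" and "0 < \<epsilon>"
  shows "j \<notin> active_set_estimate f \<epsilon> x"
proof
  let ?g = "gradient f x"
  assume "j \<in> active_set_estimate f \<epsilon> x"
  then have "x $ j \<le> \<epsilon> * (?g $ j - ?g \<bullet> x)"
    by (simp add: active_set_estimate_def inner_diff_right inner_axis)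
  moreover have "0 \<le> x $ j"
    using x by (simp add: std_simplex_def)
  ultimately have "0 \<le> ?g $ j - ?g \<bullet> x"
    using \<open>0 < \<epsilon>\<close> by (meson order_trans zero_le_mult_iff not_less)
  with min_gradient_le[OF x j] have eq: "?g \<bullet> x = ?g $ j" by simp
  have "stationary_point f x"
    unfolding stationary_point_def
  proof (intro conjI exI)
    show "?g - ?g $ j *\<^sub>R vec 1 - (?g - ?g $ j *\<^sub>R vec 1) = 0" by simp
    show "(?g - ?g $ j *\<^sub>R vec 1) \<bullet> x = 0"
      using x eq by (simp add: inner_diff_left std_simplex_def)
    show "\<forall>i. 0 \<le> (?g - ?g $ j *\<^sub>R vec 1) $ i"
      using j by (simp add: min_gradient_indices_def is_arg_min_linorder)
  qed (fact x)
  with ns show False ..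
qed

theorem proposition2:
  fixes f :: "real ^ 'n \<Rightarrow> real"
    and L C \<epsilon> :: real
    and x x' :: "real ^ 'n"
    and j :: 'n
    and A' :: "'n set"
  assumes "f differentiable_on UNIV"
    and "continuous_on UNIV (gradient f)"
    and "L > 0"
    and "L-lipschitz_on std_simplex (gradient f)"
    and "C > 0"
    and "0 < \<epsilon>"
    and "\<epsilon> \<le> 2 / (real CARD('n) * L * (2 * C + 1))"
    and "x \<in> std_simplex"
    and "\<not> stationary_point f x"
    and "j \<in> min_gradient_indices f x"
    and "A' \<subseteq> active_set_estimate f \<epsilon> x"
    and "\<forall>i\<in>A'. x' $ i = 0"
    and "\<forall>i\<in>(UNIV - {j}) - A'. x' $ i = x $ i"
    and "x' $ j = x $ j + (\<Sum>i\<in>A'. x $ i)"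
  shows "f x' - f x \<le> - C * L * (norm (x' - x))\<^sup>2"
proof -
  define g where "g = gradient f x"
  define d where "d = x' - x"
  define s where "s = (\<Sum>i\<in>A'. (x $ i)\<^sup>2)"
  let ?n = "real CARD('n)"
  have x_nonneg: "0 \<le> x $ i" for i
    using assms(8) by (simp add: std_simplex_def)
  \<comment> \<open>Non-stationarity enters here; it keeps the two prescriptions for
    \<open>x' $ j\<close> from clashing.\<close>
  have jA: "j \<notin> A'"
    using min_gradient_not_active[OF assms(8-10,6)] assms(11) by blast
  \<comment> \<open>To be applied to sums built from \<open>d\<close>, which vanishes outside
    \<open>insert j A'\<close>.\<close>
  have sum_split: "(\<Sum>i\<in>UNIV. F i) = F j + (\<Sum>i\<in>A'. F i)"
    if "\<And>i. i \<noteq> j \<Longrightarrow> i \<notin> A' \<Longrightarrow> F i = 0" for F :: "'n \<Rightarrow> real"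
  proof -
    have "(\<Sum>i\<in>UNIV. F i) = (\<Sum>i\<in>insert j A'. F i)"
      using that by (intro sum.mono_neutral_right) auto
    then show ?thesis using jA by simp
  qed
  have d_j: "d $ j = (\<Sum>i\<in>A'. x $ i)"
    using assms(14) by (simp add: d_def)
  have d_A: "d $ i = - x $ i" if "i \<in> A'" for i
    using assms(12) that by (simp add: d_def)
  have d_0: "d $ i = 0" if "i \<noteq> j" "i \<notin> A'" for i
    using assms(13) that by (simp add: d_def)

  \<comment> \<open>Feasibility puts both endpoints in the set where the gradient is
    Lipschitz.\<close>
  have "x' \<in> std_simplex"
  proof -
    have "vec 1 \<bullet> d = 0"
      unfolding vec_one_inner using d_0 by (subst sum_split) (auto simp: d_j d_A sum_negf)
    then have "vec 1 \<bullet> x' = 1"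
      using assms(8) by (simp add: d_def inner_diff_right std_simplex_def)
    moreover have "0 \<le> x' $ i" for i
      using assms(12-14) x_nonneg jA
      by (cases "i = j"; cases "i \<in> A'") (auto intro!: add_nonneg_nonneg sum_nonneg)
    ultimately show ?thesis by (simp add: std_simplex_def)
  qed
  then have descent: "f x' - f x \<le> g \<bullet> d + L / 2 * (norm d)\<^sup>2"
    unfolding g_def d_def using assms(1,4,8) convex_std_simplex
    by (intro descent_lemma) (auto simp: differentiable_on_def)

  \<comment> \<open>The left side is the contribution to \<open>\<epsilon> * (g \<bullet> d)\<close>
    of moving the mass \<open>x $ i\<close> from \<open>i\<close> to \<open>j\<close>.\<close>
  have "x $ i * (\<epsilon> * (g $ j - g $ i)) \<le> - (x $ i)\<^sup>2" if "i \<in> A'" for i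
  proof -
    have "x $ i \<le> \<epsilon> * (g $ i - g \<bullet> x)"
      using assms(11) that
      by (auto simp: active_set_estimate_def g_def inner_diff_right inner_axis)
    also have "\<dots> \<le> \<epsilon> * (g $ i - g $ j)"
      using min_gradient_le[OF assms(8,10)] assms(6) by (simp add: g_def)
    finally have "x $ i * x $ i \<le> x $ i * (\<epsilon> * (g $ i - g $ j))"
      using x_nonneg by (rule mult_left_mono)
    then show ?thesis by (simp add: power2_eq_square algebra_simps)
  qed
  then have "(\<Sum>i\<in>A'. x $ i * (\<epsilon> * (g $ j - g $ i))) \<le> - s"
    unfolding s_def sum_negf[symmetric] by (rule sum_mono)
  moreover have "\<epsilon> * (g \<bullet> d) = (\<Sum>i\<in>A'. x $ i * (\<epsilon> * (g $ j - g $ i)))"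
  proof -
    have "g \<bullet> d = g $ j * d $ j + (\<Sum>i\<in>A'. g $ i * d $ i)"
      unfolding inner_vec_def inner_real_def using d_0 by (subst sum_split) auto
    also have "\<dots> = (\<Sum>i\<in>A'. x $ i * (g $ j - g $ i))"
      by (simp add: d_j d_A sum_distrib_left sum_negf sum_subtractf algebra_simps)
    finally show ?thesis by (simp add: sum_distrib_left algebra_simps)
  qed
  ultimately have inner_bound: "\<epsilon> * (g \<bullet> d) \<le> - s" by simp

  have norm_bound: "(norm d)\<^sup>2 \<le> ?n * s"
  proof -
    have "(norm d)\<^sup>2 = (\<Sum>i\<in>A'. x $ i)\<^sup>2 + s"
      unfolding power2_norm_eq_inner inner_vec_def inner_real_def
      using d_0 by (subst sum_split) (auto simp: d_j d_A s_def power2_eq_square)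
    \<comment> \<open>Cauchy-Schwarz yields the factor \<open>card A'\<close>; the remaining
      \<open>s\<close> raises it to \<open>card A' + 1\<close>, which is still at most
      \<open>?n\<close> because \<open>j \<notin> A'\<close>.\<close>
    also have "(\<Sum>i\<in>A'. x $ i)\<^sup>2 \<le> real (card A') * s"
      unfolding s_def using sum_squared_le_sum_of_squares by (subst mult.commute)
    also have "real (card A') * s + s = real (card (insert j A')) * s"
      using jA by (simp add: algebra_simps)
    also have "\<dots> \<le> ?n * s"
      by (intro mult_right_mono) (auto simp: s_def intro!: sum_nonneg card_mono)
    finally show ?thesis by simp
  qed

  \<comment> \<open>The factor \<open>2 * C + 1\<close> leaves room for the quadratic term of the
    descent lemma: \<open>- L * (2 * C + 1) / 2 + L / 2 = - C * L\<close>.\<close>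
  have "\<epsilon> * (?n * L * (2 * C + 1)) \<le> 2"
    using assms(3,5,7) by (simp add: pos_le_divide_eq)
  then have "s * (\<epsilon> * (?n * L * (2 * C + 1))) \<le> s * 2"
    by (rule mult_left_mono) (simp add: s_def sum_nonneg)
  moreover have "\<epsilon> * L * (2 * C + 1) * (norm d)\<^sup>2 \<le> \<epsilon> * L * (2 * C + 1) * (?n * s)"
    using norm_bound assms(3,5,6) by (intro mult_left_mono) auto
  ultimately have "\<epsilon> * L * (2 * C + 1) * (norm d)\<^sup>2 \<le> 2 * s"
    by (simp add: mult_ac)
  with inner_bound have "\<epsilon> * (g \<bullet> d) \<le> \<epsilon> * (- (L * (2 * C + 1) / 2 * (norm d)\<^sup>2))"
    by (simp add: field_simps)
  then have "g \<bullet> d \<le> - (L * (2 * C + 1) / 2 * (norm d)\<^sup>2)"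
    using assms(6) by (rule mult_left_le_imp_le)
  with descent show ?thesis
    by (simp add: d_def field_simps)
qed

end
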